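(* Let $n,m\ge 1$ be integers, $A\in\mathbb{R}^{m\times n}$, $b\in\mathbb{R}^m$, $c,l,u\in\mathbb{R}^n$, and let $D=\{x\in\{0,1\}^n : Ax\le b,\ l\le x\le u\}$ be the feasible region of the binary integer program $\min_{x\in D} c^\top x$. Let $\hat x_I\in\{0,1\}^{I}$ be a partial solution on an index set $I=I_0\cup I_1\subseteq\{1,\dots,n\}$, obtained from a prediction vector $\hat p\in[0,1]^n$ and sizes $(k_0,k_1)$ as described in the context, and let $\Delta>0$ be a real number (the radius). Let $$z^{Fixing}=\min_{x\in D\cap S(\hat x_I)} c^\top x ,\qquad z^{Search}=\min_{x\in D\cap B(\hat x_I,\Delta)} c^\top x$$ be the optimal values of the fixing sub-problem and of the search sub-problem, both formed with the same partial solution $\hat x_I$, where $$S(\hat x_I)=\{x\in\mathbb{R}^n : x_I=\hat x_I\},\qquad B(\hat x_I,\Delta)=\{x\in\mathbb{R}^n : \|\hat x_I-x_I\|_1\le\Delta\}.$$ Then $z^{Search}\le z^{Fixing}$.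
   Context: For $x\in\mathbb{R}^n$ and an index set $I\subseteq\{1,\dots,n\}$, $x_I\in\mathbb{R}^{|I|}$ denotes the subvector of $x$ with coordinates indexed by $I$, and $\|\cdot\|_1$ is the $\ell_1$ norm. Vector inequalities are componentwise. Partial solution: given a vector $\hat p=(\hat p_1,\dots,\hat p_n)\in[0,1]^n$ (the predicted marginal probabilities, $\hat p_d$ being the predicted probability that $x_d=1$) and nonnegative integers $k_0,k_1$ with $k_0+k_1\le n$, let $I_0$ be the set of indices of the $k_0$ smallest components of $\hat p$ and $I_1$ the set of indices of the $k_1$ largest components of $\hat p$ (ties broken so that $I_0\cap I_1=\emptyset$), and put $I=I_0\cup I_1$. The partial solution $\hat x_I$ is defined by $\hat x_d=0$ if $d\in I_0$ and $\hat x_d=1$ if $d\in I_1$. Convention: the optimal value of a minimization problem with empty feasible set is $+\infty$. *)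

theory Defs
  imports "HOL-Analysis.Analysis"
begin

(* The order on real^'m and real^'n is the componentwise one (less_eq_vec_def). *)
definition feasible_region ::
  "real^'n^'m \<Rightarrow> real^'m \<Rightarrow> real^'n \<Rightarrow> real^'n \<Rightarrow> (real^'n) set" where
  "feasible_region A b l u =
     {x. (\<forall>d. x $ d \<in> {0, 1}) \<and> A *v x \<le> b \<and> l \<le> x \<and> x \<le> u}"

(* "The" k smallest (largest) components are determined only up to ties, so these are
   predicates on index sets that admit every way of breaking ties. *)
definition indices_of_smallest :: "real^'n \<Rightarrow> nat \<Rightarrow> 'n set \<Rightarrow> bool" where
  "indices_of_smallest p k J \<longleftrightarrow> card J = k \<and> (\<forall>i\<in>J. \<forall>j\<in>-J. p $ i \<le> p $ j)"

definition indices_of_largest :: "real^'n \<Rightarrow> nat \<Rightarrow> 'n set \<Rightarrow> bool" where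
  "indices_of_largest p k J \<longleftrightarrow> card J = k \<and> (\<forall>i\<in>J. \<forall>j\<in>-J. p $ j \<le> p $ i)"

(* A vector indexed by I is encoded as a function that is undefined outside I, so that
   equality of functions is equality of the coordinates in I. *)
definition subvector :: "real^'n \<Rightarrow> 'n set \<Rightarrow> 'n \<Rightarrow> real" where
  "subvector x I = (\<lambda>d\<in>I. x $ d)"

definition partial_solution :: "'n set \<Rightarrow> 'n set \<Rightarrow> 'n \<Rightarrow> real" where
  "partial_solution I0 I1 = (\<lambda>d\<in>I0 \<union> I1. if d \<in> I0 then 0 else 1)"

definition l1_norm_on :: "'n set \<Rightarrow> ('n \<Rightarrow> real) \<Rightarrow> real" where
  "l1_norm_on I v = (\<Sum>d\<in>I. \<bar>v d\<bar>)"

definition fixing_set :: "'n set \<Rightarrow> ('n \<Rightarrow> real) \<Rightarrow> (real^'n) set" where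
  "fixing_set I xh = {x. subvector x I = xh}"

definition search_ball :: "'n set \<Rightarrow> ('n \<Rightarrow> real) \<Rightarrow> real \<Rightarrow> (real^'n) set" where
  "search_ball I xh \<Delta> = {x. l1_norm_on I (\<lambda>d. xh d - subvector x I d) \<le> \<Delta>}"

(* Min is a genuine minimum only on finite sets; see finite_feasible_region. *)
definition optimal_value :: "real^'n \<Rightarrow> (real^'n) set \<Rightarrow> ereal" where
  "optimal_value c X = (if X = {} then \<infinity> else ereal (Min ((\<lambda>x. c \<bullet> x) ` X)))"

lemma finite_feasible_region:
  fixes A :: "real^'n^'m"
  shows "finite (feasible_region A b l u)"
proof -
  have "x \<in> vec_lambda ` (UNIV \<rightarrow>\<^sub>E {0, 1})"
    if "x \<in> feasible_region A b l u" for x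
    using that by (intro image_eqI[of _ _ "\<lambda>d. x $ d"]) (auto simp: feasible_region_def)
  moreover have "finite (vec_lambda ` ((UNIV :: 'n set) \<rightarrow>\<^sub>E {0, 1::real}))"
    by (intro finite_imageI finite_PiE) auto
  ultimately show ?thesis by (meson finite_subset subsetI)
qed

end

theory Submission
  imports Defs
begin

text \<open>A point that agrees with the partial solution on \<open>I0 \<union> I1\<close> is at l1
  distance 0 from it, hence in every ball of nonnegative radius
  (\<open>fixing_set_subset_search_ball\<close>). The search sub-problem therefore minimizes the
  same objective over a larger set, which can only lower the optimum
  (\<open>optimal_value_antimono\<close>).\<close>

lemma optimal_value_antimono:
  assumes "X \<subseteq> Y" and "finite Y"
  shows "optimal_value c Y \<le> optimal_value c X"
proof (cases "X = {}")
  case True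
  then show ?thesis by (simp add: optimal_value_def)
next
  case False
  then have "Min ((\<lambda>x. c \<bullet> x) ` Y) \<le> Min ((\<lambda>x. c \<bullet> x) ` X)"
    using assms by (intro Min_antimono) auto
  then show ?thesis
    \<comment> \<open>\<open>Y\<close> contains the nonempty \<open>X\<close>, so neither value is
      the default \<infinity>.\<close>
    using False assms(1) by (auto simp: optimal_value_def)
qed

text \<open>Every summand of the norm is 0 once \<open>xh\<close> is
  \<open>subvector x I\<close>.\<close>

lemma fixing_set_subset_search_ball:
  assumes "\<Delta> \<ge> 0"
  shows "fixing_set I xh \<subseteq> search_ball I xh \<Delta>"
  using assms by (auto simp: fixing_set_def search_ball_def l1_norm_on_def)

theorem proposition1:
  fixes A :: "real^'n^'m" and b :: "real^'m" and c l u p :: "real^'n"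
    and k0 k1 :: nat and I0 I1 :: "'n set" and \<Delta> :: real
  assumes "\<And>d. p $ d \<in> {0..1}"
    and "k0 + k1 \<le> CARD('n)"
    and "indices_of_smallest p k0 I0"
    and "indices_of_largest p k1 I1"
    and "I0 \<inter> I1 = {}"
    and "\<Delta> > 0"
  shows "optimal_value c (feasible_region A b l u
             \<inter> search_ball (I0 \<union> I1) (partial_solution I0 I1) \<Delta>)
       \<le> optimal_value c (feasible_region A b l u
             \<inter> fixing_set (I0 \<union> I1) (partial_solution I0 I1))"
  using fixing_set_subset_search_ball[of \<Delta> "I0 \<union> I1" "partial_solution I0 I1"] assms(6)
  by (intro optimal_value_antimono) (auto simp: finite_feasible_region)

end
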